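(* Let $(X_1,Y_1),\dots,(X_4,Y_4)$ be i.i.d. pairs of random vectors from a joint distribution $P_{XY}$, with $X\in\mathbb{R}^p$ and $Y\in\mathbb{R}^q$. Then the multivariate sign covariance $\tau^\ast_{p,q}$ can be written as $$\tau^\ast_{p,q}=\mathbb{E}\big[h_p(X_1,X_2,X_3,X_4)\,h_q(Y_1,Y_2,Y_3,Y_4)\big]+\mathbb{E}\big[h_p(X_1,X_2,X_3,X_4)\,h_q(Y_3,Y_4,Y_1,Y_2)\big]$$ $$-2\,\mathbb{E}\big[h_p(X_1,X_2,X_3,X_4)\,h_q(Y_1,Y_3,Y_2,Y_4)\big].$$
   Context: $\lambda$ denotes the uniform probability measure on the relevant unit sphere. Standing assumption: $\alpha^\top X$ and $\beta^\top Y$ have continuous distribution functions for $\lambda$-almost all $\alpha\in\mathbb{S}^{p-1}$ and $\lambda$-almost all $\beta\in\mathbb{S}^{q-1}$. With $a_{\mathrm{sign}}(z_1,z_2,z_3,z_4)=\mathrm{sign}(|z_1-z_2|+|z_3-z_4|-|z_1-z_3|-|z_2-z_4|)$ for real $z_i$, the multivariate $\tau^\ast$ is defined by $$\tau^\ast_{p,q}=\int_{\mathbb{S}^{p-1}}\int_{\mathbb{S}^{q-1}}\mathbb{E}\big[a_{\mathrm{sign}}(\alpha^\top X_1,\alpha^\top X_2,\alpha^\top X_3,\alpha^\top X_4)\,a_{\mathrm{sign}}(\beta^\top Y_1,\beta^\top Y_2,\beta^\top Y_3,\beta^\top Y_4)\big]d\lambda(\alpha)\,d\lambda(\beta).$$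 For $U_1,U_2,U_3\in\mathbb{R}^d$, $\mathsf{Ang}(U_i,U_j)=\arccos\{U_i^\top U_j/(\|U_i\|\|U_j\|)\}$ and $$g_d(U_1,U_2,U_3)=\tfrac12-\tfrac1{4\pi}\big[\mathsf{Ang}(U_1,U_2)+\mathsf{Ang}(U_1,U_3)+\mathsf{Ang}(U_2,U_3)\big],$$ $$h_d(Z_1,Z_2,Z_3,Z_4)=g_d(Z_1-Z_2,Z_2-Z_3,Z_3-Z_4)+g_d(Z_2-Z_1,Z_1-Z_3,Z_3-Z_4)$$ $$+g_d(Z_1-Z_2,Z_2-Z_4,Z_4-Z_3)+g_d(Z_2-Z_1,Z_1-Z_4,Z_4-Z_3).$$
   Formalization: The right-hand side is multiplied by 4 (coefficients 4, 4, −8 instead of 1, 1, −2); the printed identity fails for p = q = 1 and X = Y with continuous law, where τ* = 2/3 but the printed right-hand side is 1/6. *)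

theory Defs
  imports "HOL-Probability.Probability"
begin

text \<open>
  The uniform probability measure on the unit sphere, as a Borel measure on the ambient
  space that is concentrated on the sphere: the law of \<open>x / \<parallel>x\<parallel>\<close> for \<open>x\<close> uniform in the unit
  ball. It inherits rotation invariance from Lebesgue measure on the ball, so it is the normalised
  surface measure; in dimension one it gives mass 1/2 to each of 1 and -1. The value \<open>sgn 0 = 0\<close>
  is irrelevant, since the origin is a null set.
\<close>

definition uniform_sphere :: "(real ^ 'n) measure" where
  "uniform_sphere = distr (uniform_measure lborel (ball 0 1)) borel sgn"

lemma emeasure_unit_ball:
  "emeasure lborel (ball (0 :: real ^ 'n) 1) \<noteq> 0"
  "emeasure lborel (ball (0 :: real ^ 'n) 1) \<noteq> \<infinity>"
proof -
  show "emeasure lborel (ball (0 :: real ^ 'n) 1) \<noteq> 0"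
    using open_not_negligible[of "ball (0 :: real ^ 'n) 1"]
    by (auto simp: negligible_iff_emeasure0 emeasure_completion)
  show "emeasure lborel (ball (0 :: real ^ 'n) 1) \<noteq> \<infinity>"
    using emeasure_bounded_finite[of "ball (0 :: real ^ 'n) 1"] by auto
qed

lemma prob_space_uniform_sphere: "prob_space (uniform_sphere :: (real ^ 'n) measure)"
  unfolding uniform_sphere_def
  by (intro prob_space.prob_space_distr prob_space_uniform_measure emeasure_unit_ball) simp

lemma AE_uniform_sphere: "AE \<alpha> in uniform_sphere. \<alpha> \<in> sphere (0 :: real ^ 'n) 1"
proof -
  have "AE x in lborel. x \<noteq> (0 :: real ^ 'n)"
    by (rule AE_lborel_singleton)
  then show ?thesis
    unfolding uniform_sphere_def
    using emeasure_unit_ball[where 'n = 'n]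
    by (subst AE_distr_iff) (auto simp: norm_sgn less_top intro!: AE_uniform_measureI)
qed

definition a_sign :: "real \<Rightarrow> real \<Rightarrow> real \<Rightarrow> real \<Rightarrow> real" where
  "a_sign z1 z2 z3 z4 = sgn (\<bar>z1 - z2\<bar> + \<bar>z3 - z4\<bar> - \<bar>z1 - z3\<bar> - \<bar>z2 - z4\<bar>)"

definition Ang :: "real ^ 'd \<Rightarrow> real ^ 'd \<Rightarrow> real" where
  "Ang u v = arccos (u \<bullet> v / (norm u * norm v))"

definition g_fun :: "real ^ 'd \<Rightarrow> real ^ 'd \<Rightarrow> real ^ 'd \<Rightarrow> real" where
  "g_fun u1 u2 u3 = 1 / 2 - 1 / (4 * pi) * (Ang u1 u2 + Ang u1 u3 + Ang u2 u3)"

definition h_fun :: "real ^ 'd \<Rightarrow> real ^ 'd \<Rightarrow> real ^ 'd \<Rightarrow> real ^ 'd \<Rightarrow> real" where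
  "h_fun z1 z2 z3 z4 =
     g_fun (z1 - z2) (z2 - z3) (z3 - z4) + g_fun (z2 - z1) (z1 - z3) (z3 - z4)
   + g_fun (z1 - z2) (z2 - z4) (z4 - z3) + g_fun (z2 - z1) (z1 - z4) (z4 - z3)"

text \<open>
  The multivariate sign covariance \<open>\<tau>\<^sup>*\<close>, expressed with the sample \<open>(X i, Y i)\<close>, \<open>i = 1, \<dots>, 4\<close>, on the
  probability space \<open>M\<close>. In its representation through \<open>h_fun\<close> the three expectations carry
  the coefficients 4, 4, -8, as in the univariate formula of Bergsma and Dassios. The source
  prints 1, 1, -2 instead, which is inconsistent with its own definitions: for p = q = 1 and
  \<open>X = Y\<close> with a continuous law, \<open>\<tau>\<^sup>* = 2/3\<close>, whereas the expectations are 1/12, 1/12 and 0.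
\<close>

definition tau_star ::
  "'a measure \<Rightarrow> (nat \<Rightarrow> 'a \<Rightarrow> real ^ 'p) \<Rightarrow> (nat \<Rightarrow> 'a \<Rightarrow> real ^ 'q) \<Rightarrow> real" where
  "tau_star M X Y =
     (\<integral>\<alpha>. (\<integral>\<beta>. (\<integral>\<omega>.
         a_sign (\<alpha> \<bullet> X 1 \<omega>) (\<alpha> \<bullet> X 2 \<omega>) (\<alpha> \<bullet> X 3 \<omega>) (\<alpha> \<bullet> X 4 \<omega>)
       * a_sign (\<beta> \<bullet> Y 1 \<omega>) (\<beta> \<bullet> Y 2 \<omega>) (\<beta> \<bullet> Y 3 \<omega>) (\<beta> \<bullet> Y 4 \<omega>) \<partial>M)
       \<partial>uniform_sphere) \<partial>uniform_sphere)"

end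

theory Submission
  imports Defs
begin

text \<open>
  Write \<open>S(z\<^sub>1, z\<^sub>2, z\<^sub>3, z\<^sub>4)\<close> for the probability that a uniform direction separates \<open>z\<^sub>1, z\<^sub>2\<close> from
  \<open>z\<^sub>3, z\<^sub>4\<close>, with the first pair on top. For distinct points \<open>h\<close> equals \<open>S\<close>: up to null sets, the
  separation splits into the four orderings of the projections, each of which is an intersection of
  three half-spaces. The measure of such an intersection follows by inclusion-exclusion and the
  antipodal symmetry from that of two half-spaces, and the latter is linear in the angle because
  the measure of a wedge is rotation invariant and additive in its opening angle.
  Since \<open>a_sign\<close> is a signed sum of four separation indicators, its average over all directions is
  \<open>2 (S(z\<^sub>1, z\<^sub>3, z\<^sub>2, z\<^sub>4) - S(z\<^sub>1, z\<^sub>2, z\<^sub>3, z\<^sub>4))\<close>. Fubini, followed by exchanging the second and the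
  third observation, then gives the formula; the sample points are almost surely distinct because
  their projections onto some direction are independent with a continuous law.
\<close>

subsection \<open>Rotation invariance\<close>

text \<open>
  The uniqueness of Haar measure: integrate \<open>indicator A x * indicator (ball 0 1) (y - x)\<close> in both
  orders, substituting \<open>y + x\<close> for \<open>x\<close> in the second one.
\<close>

lemma translation_invariant_eq_lborel:
  fixes N :: "'a::euclidean_space measure"
  assumes sets_N [measurable_cong]: "sets N = sets borel"
    and "sigma_finite_measure N"
    and transl: "\<And>c. distr N borel ((+) c) = N"
    and ball: "emeasure N (ball 0 1) = emeasure lborel (ball (0::'a) 1)"
  shows "N = lborel"
proof (rule measure_eqI)
  interpret N: sigma_finite_measure N by fact
  interpret NL: pair_sigma_finite lborel N ..
  fix A assume "A \<in> sets N"
  then have A [measurable]: "A \<in> sets borel" by (simp add: sets_N)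
  let ?B = "ball (0::'a) 1"
  have [measurable]: "?B \<in> sets borel" by simp
  have transl_N: "(\<integral>\<^sup>+x. f x \<partial>N) = (\<integral>\<^sup>+x. f (c + x) \<partial>N)" if [measurable]: "f \<in> borel_measurable borel" for f c
    by (subst (1) transl[of c, symmetric], subst nn_integral_distr) auto
  have transl_L: "(\<integral>\<^sup>+x. f x \<partial>lborel) = (\<integral>\<^sup>+x. f (c + x) \<partial>lborel)"
    if [measurable]: "f \<in> borel_measurable borel" for f and c :: 'a
    by (subst (1) lborel_distr_plus[of c, symmetric], subst nn_integral_distr) auto
  have "emeasure lborel ?B * emeasure N A
      = (\<integral>\<^sup>+x. indicator A x * (\<integral>\<^sup>+y. indicator ?B y \<partial>lborel) \<partial>N)"
    by (simp add: nn_integral_multc mult.commute sets_N)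
  also have "\<dots> = (\<integral>\<^sup>+x. (\<integral>\<^sup>+y. indicator A x * indicator ?B (y - x) \<partial>lborel) \<partial>N)"
  proof (intro nn_integral_cong)
    fix x
    have "(\<integral>\<^sup>+y. indicator ?B y \<partial>lborel) = (\<integral>\<^sup>+y. indicator ?B (y - x) \<partial>lborel)"
      by (subst transl_L[where c = "- x"]) auto
    then show "indicator A x * (\<integral>\<^sup>+y. indicator ?B y \<partial>lborel)
        = (\<integral>\<^sup>+y. indicator A x * indicator ?B (y - x) \<partial>lborel)"
      by (simp add: nn_integral_cmult)
  qed
  also have "\<dots> = (\<integral>\<^sup>+y. (\<integral>\<^sup>+x. indicator A x * indicator ?B (y - x) \<partial>N) \<partial>lborel)"
    by (rule NL.Fubini') measurable
  \<comment> \<open>After the shift by y the argument of the ball indicator is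
    \<open>y - (y + x) = - x\<close>; the symmetry of the ball absorbs the sign.\<close>
  also have "\<dots> = (\<integral>\<^sup>+y. (\<integral>\<^sup>+x. indicator A (y + x) * indicator ?B x \<partial>N) \<partial>lborel)"
  proof (rule nn_integral_cong)
    fix y
    show "(\<integral>\<^sup>+x. indicator A x * indicator ?B (y - x) \<partial>N)
        = (\<integral>\<^sup>+x. indicator A (y + x) * indicator ?B x \<partial>N)"
      by (subst transl_N[where c = y]) (auto simp: indicator_def intro!: nn_integral_cong)
  qed
  also have "\<dots> = (\<integral>\<^sup>+x. (\<integral>\<^sup>+y. indicator A (x + y) * indicator ?B x \<partial>lborel) \<partial>N)"
    by (subst NL.Fubini') (auto simp: add.commute)
  also have "\<dots> = (\<integral>\<^sup>+x. emeasure lborel A * indicator ?B x \<partial>N)"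
    by (intro nn_integral_cong) (subst nn_integral_multc, auto simp: transl_L[symmetric])
  also have "\<dots> = emeasure lborel A * emeasure lborel ?B"
    by (subst nn_integral_cmult) (auto simp: ball sets_N)
  finally have "emeasure lborel ?B * emeasure N A = emeasure lborel ?B * emeasure lborel A"
    by (simp add: mult.commute)
  moreover have "emeasure lborel ?B \<noteq> 0"
    using open_not_negligible[of ?B] by (auto simp: negligible_iff_emeasure0 emeasure_completion)
  moreover have "emeasure lborel ?B < \<infinity>"
    by (rule emeasure_bounded_finite) simp
  ultimately show "emeasure N A = emeasure lborel A"
    by (auto simp: ennreal_mult_cancel_left)
qed (simp add: sets_N)

lemma measurable_orthogonal:
  fixes T :: "'a::euclidean_space \<Rightarrow> 'a"
  shows "orthogonal_transformation T \<Longrightarrow> T \<in> borel_measurable borel"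
  by (intro borel_measurable_continuous_onI linear_continuous_on
      linear_conv_bounded_linear[THEN iffD1] orthogonal_transformation_linear)

text \<open>The library fact \<open>measure_orthogonal_image\<close> is restricted to a well-ordered index type.\<close>

lemma distr_lborel_orthogonal:
  fixes T :: "'a::euclidean_space \<Rightarrow> 'a"
  assumes T: "orthogonal_transformation T"
  shows "distr lborel borel T = lborel"
proof (rule translation_invariant_eq_lborel)
  note [measurable] = measurable_orthogonal[OF T]
  have ball: "emeasure (distr lborel borel T) (ball 0 r) = emeasure lborel (ball (0::'a) r)" for r
    using T by (subst emeasure_distr)
      (auto intro!: arg_cong[where f = "emeasure lborel"] simp: orthogonal_transformation)
  then show "emeasure (distr lborel borel T) (ball 0 1) = emeasure lborel (ball (0::'a) 1)" .
  show "sigma_finite_measure (distr lborel borel T)"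
  proof (standard, intro exI[of _ "range (\<lambda>n::nat. ball (0::'a) n)"] conjI)
    show "\<Union> (range (\<lambda>n::nat. ball (0::'a) n)) = space (distr lborel borel T)"
      by (auto simp: reals_Archimedean2)
    show "\<forall>a\<in>range (\<lambda>n::nat. ball (0::'a) n). emeasure (distr lborel borel T) a \<noteq> \<infinity>"
      using emeasure_bounded_finite[of "ball (0::'a) _"] by (auto simp: ball less_top)
  qed auto
  fix c
  \<comment> \<open>By linearity, translating by c after T is T after translating by the preimage d,
    so the image measure inherits translation invariance.\<close>
  obtain d where d: "T d = c"
    using orthogonal_transformation_surj[OF T] by (metis surjD)
  have "distr (distr lborel borel T) borel ((+) c) = distr lborel borel ((+) c \<circ> T)"
    by (subst distr_distr) auto
  also have "(+) c \<circ> T = T \<circ> (+) d"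
    using T d by (auto simp: fun_eq_iff orthogonal_transformation_def linear_add)
  also have "distr lborel borel (T \<circ> (+) d) = distr (distr lborel borel ((+) d)) borel T"
    by (subst distr_distr) auto
  finally show "distr (distr lborel borel T) borel ((+) c) = distr lborel borel T"
    by (simp add: lborel_distr_plus)
qed auto

section \<open>Symmetries and null sets of the uniform measure on the sphere\<close>

lemma sets_uniform_sphere [simp, measurable_cong]: "sets uniform_sphere = sets borel"
  and space_uniform_sphere [simp]: "space uniform_sphere = UNIV"
  by (auto simp: uniform_sphere_def)

interpretation uniform_sphere: prob_space "uniform_sphere :: (real ^ 'n) measure"
  by (rule prob_space_uniform_sphere)

text \<open>T preserves both Lebesgue measure and the unit ball, hence the uniform law on the ball.
  It commutes with \<open>sgn\<close> by linearity and preservation of norms, so the invariance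
  descends to the sphere.\<close>

lemma distr_uniform_sphere_orthogonal:
  fixes T :: "real ^ 'n \<Rightarrow> real ^ 'n"
  assumes T: "orthogonal_transformation T"
  shows "distr uniform_sphere borel T = uniform_sphere"
proof -
  note [measurable] = measurable_orthogonal[OF T]
  let ?B = "ball (0 :: real ^ 'n) 1"
  have "distr (uniform_measure lborel ?B) borel T = uniform_measure lborel ?B"
  proof (rule measure_eqI)
    fix A assume "A \<in> sets (distr (uniform_measure lborel ?B) borel T)"
    then have A [measurable]: "A \<in> sets borel" by simp
    have "emeasure lborel (?B \<inter> T -` A) = emeasure lborel (T -` (?B \<inter> A))"
      using T by (intro arg_cong[where f = "emeasure lborel"]) (auto simp: orthogonal_transformation)
    also have "\<dots> = emeasure (distr lborel borel T) (?B \<inter> A)"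
      by (subst emeasure_distr) auto
    finally have "emeasure lborel (?B \<inter> T -` A) = emeasure lborel (?B \<inter> A)"
      by (simp add: distr_lborel_orthogonal T)
    moreover have "T -` A \<in> sets borel"
      using measurable_sets[of T borel borel A] by simp
    ultimately show "emeasure (distr (uniform_measure lborel ?B) borel T) A
        = emeasure (uniform_measure lborel ?B) A"
      by (simp add: emeasure_distr)
  qed simp
  moreover have "T \<circ> sgn = sgn \<circ> T"
    using T by (auto simp: fun_eq_iff sgn_div_norm orthogonal_transformation linear_cmul)
  moreover have "distr uniform_sphere borel T = distr (uniform_measure lborel ?B) borel (T \<circ> sgn)"
    unfolding uniform_sphere_def by (subst distr_distr) auto
  moreover have "distr (uniform_measure lborel ?B) borel (sgn \<circ> T)
      = distr (distr (uniform_measure lborel ?B) borel T) borel sgn"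
    by (subst distr_distr) auto
  ultimately show ?thesis
    by (simp add: uniform_sphere_def)
qed

lemma measure_uniform_sphere_orthogonal:
  fixes T :: "real ^ 'n \<Rightarrow> real ^ 'n"
  assumes T: "orthogonal_transformation T" and [measurable]: "Measurable.pred borel P"
  shows "measure uniform_sphere {\<alpha>. P (T \<alpha>)} = measure uniform_sphere {\<alpha>. P \<alpha>}"
proof -
  note [measurable] = measurable_orthogonal[OF T]
  have "measure uniform_sphere {\<alpha>. P \<alpha>} = measure (distr uniform_sphere borel T) {\<alpha>. P \<alpha>}"
    by (simp add: distr_uniform_sphere_orthogonal T)
  also have "\<dots> = measure uniform_sphere {\<alpha>. P (T \<alpha>)}"
    by (subst measure_distr) (auto simp: vimage_def)
  finally show ?thesis ..
qed

lemma measure_uniform_sphere_uminus: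
  fixes P :: "real ^ 'n \<Rightarrow> bool"
  assumes "Measurable.pred borel P"
  shows "measure uniform_sphere {\<alpha>. P (- \<alpha>)} = measure uniform_sphere {\<alpha>. P \<alpha>}"
  using measure_uniform_sphere_orthogonal[OF _ assms, of uminus]
  by (simp add: orthogonal_transformation_def linear_iff)

text \<open>A hyperplane through the origin is Lebesgue null, and normalising a nonzero vector does
  not change whether it lies on it. This is what allows ties between projections of distinct points
  to be ignored.\<close>

lemma AE_uniform_sphere_inner_nonzero:
  assumes "u \<noteq> 0"
  shows "AE \<alpha> in uniform_sphere. \<alpha> \<bullet> (u :: real ^ 'n) \<noteq> 0"
proof -
  have "negligible {x. u \<bullet> x = 0}"
    using assms by (intro negligible_hyperplane) auto
  then have "emeasure lborel {x. u \<bullet> x = 0} = 0"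
    by (auto simp: negligible_iff_emeasure0 emeasure_completion)
  then have "AE x in lborel. u \<bullet> x \<noteq> 0"
    by (subst AE_iff_measurable[OF _ refl]) auto
  then show ?thesis
    unfolding uniform_sphere_def using emeasure_unit_ball[where 'n = 'n]
    by (subst AE_distr_iff)
      (auto simp: less_top sgn_div_norm inner_commute intro!: AE_uniform_measureI elim!: eventually_mono)
qed

subsection \<open>Intersections of half-spaces\<close>

text \<open>Cauchy's functional equation on an interval: additivity determines m at rational
  multiples of L, and nonnegativity makes m monotone, which fixes the remaining values.\<close>

lemma additive_nonneg_imp_linear:
  fixes m :: "real \<Rightarrow> real"
  assumes L: "0 < L"
    and add: "\<And>s t. 0 \<le> s \<Longrightarrow> 0 \<le> t \<Longrightarrow> s + t \<le> L \<Longrightarrow> m (s + t) = m s + m t"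
    and nonneg: "\<And>t. 0 \<le> t \<Longrightarrow> t \<le> L \<Longrightarrow> 0 \<le> m t"
    and t: "0 \<le> t" "t \<le> L"
  shows "m t = t / L * m L"
proof -
  have mono: "m s \<le> m t" if "0 \<le> s" "s \<le> t" "t \<le> L" for s t
    using add[of s "t - s"] nonneg[of "t - s"] that by simp
  have m0: "m 0 = 0"
    using add[of 0 0] L by simp
  have mult: "m (real k * s) = real k * m s" if "0 \<le> s" "real k * s \<le> L" for k s
    using that(2)
  proof (induction k)
    case (Suc k)
    then have "real k * s \<le> L"
      using that(1) by (simp add: distrib_right)
    with Suc have "m (real k * s + s) = m (real k * s) + m s"
      using that(1) by (intro add) (auto simp: distrib_right)
    with Suc \<open>real k * s \<le> L\<close> show ?case
      by (simp add: distrib_right add.commute)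
  qed (simp add: m0)
  have grid: "m (real k * L / real n) = real k * m L / real n" if "0 < n" "k \<le> n" for k n :: nat
  proof -
    have "real k * (L / real n) \<le> L"
      using that L by (simp add: field_simps)
    then show ?thesis
      using mult[of "L / real n" n] mult[of "L / real n" k] that L by (simp add: field_simps)
  qed
  \<comment> \<open>Both \<open>m t\<close> and \<open>t / L * m L\<close> lie between the values of
    m at the two grid points \<open>k * L / N\<close> and \<open>Suc k * L / N\<close> enclosing t.
    The case \<open>t = L\<close> is separate because there the right grid point would leave the
    interval.\<close>
  have bound: "\<bar>m t - t / L * m L\<bar> \<le> m L / real (Suc n)" for n
  proof (cases "t = L")
    case False
    define N where "N = Suc n"
    define k where "k = nat \<lfloor>t * N / L\<rfloor>"
    have N: "0 < N" by (simp add: N_def)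
    have "0 \<le> t * N / L" using t L by simp
    then have k: "real k \<le> t * N / L" "t * N / L < real (Suc k)"
      unfolding k_def by linarith+
    have "t * N / L < N"
      using False t L N by (simp add: field_simps)
    with k have "k < N" by simp
    have mL: "0 \<le> m L" using nonneg[of L] L by simp
    have "m (real k * L / N) \<le> m t"
      using k t L N by (intro mono) (auto simp: field_simps)
    moreover have "m t \<le> m (real (Suc k) * L / N)"
    proof (rule mono)
      show "real (Suc k) * L / N \<le> L"
        using \<open>k < N\<close> L N by (simp add: divide_le_eq mult.commute)
      show "t \<le> real (Suc k) * L / N"
        using k(2) L N by (simp add: field_simps)
    qed fact
    moreover have "m (real k * L / N) = real k / N * m L"
      "m (real (Suc k) * L / N) = real (Suc k) / N * m L"
      using grid[of N k] grid[of N "Suc k"] \<open>k < N\<close> N by simp_all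
    moreover have "real k / N * m L \<le> t / L * m L" "t / L * m L \<le> real (Suc k) / N * m L"
      using k L N mL by (intro mult_right_mono; simp add: field_simps)+
    moreover have "real (Suc k) / N * m L = real k / N * m L + m L / N"
      by (simp add: add_divide_distrib distrib_right)
    ultimately show ?thesis
      unfolding N_def by linarith
  qed (use L nonneg[of L] in simp)
  have "(\<lambda>n. m L / real (Suc n)) \<longlonglongrightarrow> 0"
    by (rule real_tendsto_divide_at_top[OF tendsto_const filterlim_compose[OF filterlim_real_sequentially filterlim_Suc]])
  then have "\<bar>m t - t / L * m L\<bar> \<le> 0"
    by (rule tendsto_lowerbound) (use bound in auto)
  then show ?thesis by simp
qed

text \<open>The antipodal map exchanges the two open half-spaces, and their common boundary is
  null.\<close>

lemma measure_halfspace: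
  fixes u :: "real ^ 'n"
  assumes "u \<noteq> 0"
  shows "measure uniform_sphere {\<alpha>. 0 < \<alpha> \<bullet> u} = 1 / 2"
proof -
  have "1 = measure uniform_sphere ({\<alpha>. 0 < \<alpha> \<bullet> u} \<union> {\<alpha>. \<alpha> \<bullet> u < 0})"
    using AE_uniform_sphere_inner_nonzero[OF assms]
    by (intro uniform_sphere.prob_eq_1[THEN iffD2, symmetric]) (auto elim!: eventually_mono)
  also have "\<dots> = measure uniform_sphere {\<alpha>. 0 < \<alpha> \<bullet> u} + measure uniform_sphere {\<alpha>. \<alpha> \<bullet> u < 0}"
    by (intro uniform_sphere.finite_measure_Union) auto
  also have "measure uniform_sphere {\<alpha>. \<alpha> \<bullet> u < 0} = measure uniform_sphere {\<alpha>. 0 < \<alpha> \<bullet> u}"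
    using measure_uniform_sphere_uminus[of "\<lambda>\<alpha>. 0 < \<alpha> \<bullet> u"] by simp
  finally show ?thesis by simp
qed

text \<open>For orthonormal \<open>e\<close>, \<open>f\<close>: rotation by \<open>s\<close> in their plane, the identity on its complement.\<close>

definition plane_rotation :: "'a::real_inner \<Rightarrow> 'a \<Rightarrow> real \<Rightarrow> 'a \<Rightarrow> 'a" where
  "plane_rotation e f s x =
     x + ((cos s - 1) * (e \<bullet> x) - sin s * (f \<bullet> x)) *\<^sub>R e
       + (sin s * (e \<bullet> x) + (cos s - 1) * (f \<bullet> x)) *\<^sub>R f"

lemma orthogonal_transformation_plane_rotation:
  assumes "norm e = 1" "norm f = 1" "e \<bullet> f = 0"
  shows "orthogonal_transformation (plane_rotation e f s)"
proof -
  have ef: "e \<bullet> e = 1" "f \<bullet> f = 1" "f \<bullet> e = 0"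
    using assms by (simp_all add: norm_eq_1 inner_commute)
  \<comment> \<open>The Pythagorean identity with a further factor z, the form in which it occurs in
    the expanded inner product.\<close>
  have sin_sin: "sin s * (sin s * z) = z - cos s * (cos s * z)" for z
  proof -
    have "sin s * sin s = 1 - cos s * cos s"
      using sin_cos_squared_add[of s] by (simp add: power2_eq_square)
    then have "sin s * (sin s * z) = (1 - cos s * cos s) * z"
      by (metis mult.assoc)
    then show ?thesis by (simp add: left_diff_distrib)
  qed
  have "plane_rotation e f s x \<bullet> plane_rotation e f s y = x \<bullet> y" for x y
    by (simp add: plane_rotation_def inner_add_left inner_add_right ef assms
        inner_commute[of x e] inner_commute[of x f] algebra_simps sin_sin)
  moreover have "linear (plane_rotation e f s)"
    by (rule linearI) (simp_all add: plane_rotation_def inner_add_right algebra_simps)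
  ultimately show ?thesis
    by (simp add: orthogonal_transformation_def)
qed

text \<open>As t runs from 0 to pi, the second normal turns from e to - e. The measure is additive
  in t and nonnegative, hence linear, and at \<open>t = pi\<close> the wedge is a half-space of
  measure 1/2.\<close>

lemma measure_wedge:
  fixes e f :: "real ^ 'n"
  assumes ef: "norm e = 1" "norm f = 1" "e \<bullet> f = 0"
    and t: "0 \<le> t" "t \<le> pi"
  shows "measure uniform_sphere {\<alpha>. 0 < \<alpha> \<bullet> e \<and> \<alpha> \<bullet> (cos t *\<^sub>R e + sin t *\<^sub>R f) < 0} = t / (2 * pi)"
proof -
  define w where "w = (\<lambda>t. cos t *\<^sub>R e + sin t *\<^sub>R f)"
  define m where "m = (\<lambda>t. measure uniform_sphere {\<alpha>. 0 < \<alpha> \<bullet> w 0 \<and> \<alpha> \<bullet> w t < 0})"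
  have ef': "e \<bullet> e = 1" "f \<bullet> f = 1" "f \<bullet> e = 0"
    using ef by (simp_all add: norm_eq_1 inner_commute)
  have w_ne: "w s \<noteq> 0" for s
  proof
    assume "w s = 0"
    moreover have "w s \<bullet> w s = 1"
      using sin_cos_squared_add[of s]
      by (simp add: w_def inner_add_left inner_add_right ef' ef power2_eq_square add.commute)
    ultimately show False by simp
  qed
  have rot: "plane_rotation e f s (w t) = w (s + t)" for s t
    by (simp add: plane_rotation_def w_def inner_add_right ef' ef cos_add sin_add algebra_simps)
  \<comment> \<open>Rotating back by s moves the wedge between angles s and s + t to the one between
    0 and t.\<close>
  have shift: "measure uniform_sphere {\<alpha>. 0 < \<alpha> \<bullet> w s \<and> \<alpha> \<bullet> w (s + t) < 0} = m t" for s t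
  proof -
    let ?R = "plane_rotation e f s"
    have R: "orthogonal_transformation ?R"
      by (intro orthogonal_transformation_plane_rotation ef)
    then have "?R \<alpha> \<bullet> w (s + t) = \<alpha> \<bullet> w t" for \<alpha> t
      by (simp add: rot[symmetric] orthogonal_transformation_def)
    from this this[of _ 0] show ?thesis
      using measure_uniform_sphere_orthogonal[OF R, of "\<lambda>\<alpha>. 0 < \<alpha> \<bullet> w s \<and> \<alpha> \<bullet> w (s + t) < 0"]
      by (simp add: m_def)
  qed
  have m0: "m 0 = 0"
  proof -
    have "{\<alpha>. 0 < \<alpha> \<bullet> w 0 \<and> \<alpha> \<bullet> w 0 < 0} = {}" by auto
    then show ?thesis by (simp only: m_def measure_empty)
  qed
  have add: "m (s + t) = m s + m t" if st: "0 \<le> s" "0 \<le> t" "s + t \<le> pi" for s t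
  proof (cases "s = 0 \<or> t = 0")
    case False
    with st have pos: "0 < sin s" "0 < sin t" "0 \<le> sin (s + t)"
      by (auto intro!: sin_gt_zero sin_ge_zero)
    \<comment> \<open>A linear relation placing \<open>w s\<close> between \<open>w 0\<close> and
      \<open>w (s + t)\<close>. Its coefficients are nonnegative because
      \<open>s + t \<le> pi\<close>, so it relates the signs of the three projections.\<close>
    have "sin t *\<^sub>R w 0 + sin s *\<^sub>R w (s + t) = sin (s + t) *\<^sub>R w s"
    proof -
      have "sin t + sin s * cos (s + t) = sin (s + t) * cos s"
        using sin_diff[of "s + t" s] by simp
      then show ?thesis
        by (simp add: w_def algebra_simps) (metis scaleR_add_left)
    qed
    then have lin: "sin t * (\<alpha> \<bullet> w 0) + sin s * (\<alpha> \<bullet> w (s + t)) = sin (s + t) * (\<alpha> \<bullet> w s)" for \<alpha>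
      by (metis inner_add_right inner_scaleR_right)
    \<comment> \<open>Off the hyperplane orthogonal to \<open>w s\<close>, the sign of the
      projection on \<open>w s\<close> cuts the large wedge into the two small ones.\<close>
    have "AE \<alpha> in uniform_sphere. (0 < \<alpha> \<bullet> w 0 \<and> \<alpha> \<bullet> w (s + t) < 0) \<longleftrightarrow>
        (0 < \<alpha> \<bullet> w 0 \<and> \<alpha> \<bullet> w s < 0) \<or> (0 < \<alpha> \<bullet> w s \<and> \<alpha> \<bullet> w (s + t) < 0)"
      using AE_uniform_sphere_inner_nonzero[OF w_ne[of s]]
    proof (rule AE_mp, intro AE_I2 impI)
      fix \<alpha> assume "\<alpha> \<bullet> w s \<noteq> 0"
      moreover have "\<alpha> \<bullet> w (s + t) < 0" if "0 < \<alpha> \<bullet> w 0" "\<alpha> \<bullet> w s < 0"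
      proof -
        have "sin (s + t) * (\<alpha> \<bullet> w s) \<le> 0" "0 < sin t * (\<alpha> \<bullet> w 0)"
          using pos that by (auto simp: mult_nonneg_nonpos)
        with lin[of \<alpha>] have "sin s * (\<alpha> \<bullet> w (s + t)) < 0" by linarith
        then show ?thesis using pos by (simp add: mult_less_0_iff)
      qed
      moreover have "0 < \<alpha> \<bullet> w 0" if "0 < \<alpha> \<bullet> w s" "\<alpha> \<bullet> w (s + t) < 0"
      proof -
        have "0 \<le> sin (s + t) * (\<alpha> \<bullet> w s)" "sin s * (\<alpha> \<bullet> w (s + t)) < 0"
          using pos that by (auto simp: mult_pos_neg)
        with lin[of \<alpha>] have "0 < sin t * (\<alpha> \<bullet> w 0)" by linarith
        then show ?thesis using pos by (simp add: zero_less_mult_iff)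
      qed
      ultimately show "(0 < \<alpha> \<bullet> w 0 \<and> \<alpha> \<bullet> w (s + t) < 0) \<longleftrightarrow>
          (0 < \<alpha> \<bullet> w 0 \<and> \<alpha> \<bullet> w s < 0) \<or> (0 < \<alpha> \<bullet> w s \<and> \<alpha> \<bullet> w (s + t) < 0)"
        by linarith
    qed
    then have "m (s + t) = measure uniform_sphere ({\<alpha>. 0 < \<alpha> \<bullet> w 0 \<and> \<alpha> \<bullet> w s < 0} \<union>
        {\<alpha>. 0 < \<alpha> \<bullet> w s \<and> \<alpha> \<bullet> w (s + t) < 0})"
      unfolding m_def by (intro uniform_sphere.finite_measure_eq_AE) auto
    also have "\<dots> = m s + m t"
      by (subst uniform_sphere.finite_measure_Union) (auto simp: shift, simp add: m_def)
    finally show ?thesis .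
  qed (auto simp: m0)
  have "w 0 = e" "w pi = - e"
    by (simp_all add: w_def)
  then have "m pi = 1 / 2"
    using measure_halfspace[OF w_ne[of 0]] by (simp add: m_def)
  moreover have "m t = t / pi * m pi"
    using t by (intro additive_nonneg_imp_linear add) (simp_all add: m_def)
  ultimately have "m t = t / (2 * pi)" by (simp only:) simp
  then show ?thesis
    by (simp add: m_def \<open>w 0 = e\<close>) (simp add: w_def)
qed

text \<open>The intersection is the half-space of u minus a wedge whose opening is the angle between
  u and v, taken in the plane that they span.\<close>

lemma measure_two_halfspaces:
  fixes u v :: "real ^ 'n"
  assumes "u \<noteq> 0" "v \<noteq> 0"
  shows "measure uniform_sphere {\<alpha>. 0 < \<alpha> \<bullet> u \<and> 0 < \<alpha> \<bullet> v} = 1 / 2 - Ang u v / (2 * pi)"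
proof -
  \<comment> \<open>Positive rescaling changes neither the half-spaces nor the angle, so unit
    vectors suffice.\<close>
  define e where "e = sgn u"
  define x where "x = sgn v"
  define c where "c = e \<bullet> x"
  have e: "norm e = 1" and x: "norm x = 1"
    using assms by (simp_all add: e_def x_def norm_sgn)
  have "e \<noteq> 0" and "x \<noteq> 0"
    using assms by (simp_all add: e_def x_def sgn_zero_iff)
  have Ang: "Ang u v = arccos c"
    by (simp add: Ang_def c_def e_def x_def sgn_div_norm divide_inverse mult_ac)
  have "measure uniform_sphere {\<alpha>. 0 < \<alpha> \<bullet> u \<and> 0 < \<alpha> \<bullet> v}
      = measure uniform_sphere {\<alpha>. 0 < \<alpha> \<bullet> e \<and> 0 < \<alpha> \<bullet> x}"
    using assms by (simp add: e_def x_def sgn_div_norm zero_less_mult_iff)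
  also have "\<dots> = 1 / 2 - arccos c / (2 * pi)"
  proof -
    have "\<bar>c\<bar> \<le> 1"
      using Cauchy_Schwarz_ineq2[of e x] e x by (simp add: c_def)
    moreover have "x = e" if "c = 1"
    proof -
      have "(x - e) \<bullet> (x - e) = 0"
        using e x that by (simp add: inner_diff_left inner_diff_right c_def norm_eq_1 inner_commute)
      then show ?thesis by simp
    qed
    moreover have "x = - e" if "c = -1"
    proof -
      have "(x + e) \<bullet> (x + e) = 0"
        using e x that by (simp add: inner_add_left inner_add_right c_def norm_eq_1 inner_commute)
      then show ?thesis by (simp add: eq_neg_iff_add_eq_0)
    qed
    \<comment> \<open>Collinear vectors span no plane and are treated directly; in dimension one
      these are the only cases.\<close>
    ultimately consider "x = e" "c = 1" | "x = - e" "c = -1" | "\<bar>c\<bar> < 1"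
      by linarith
    then show ?thesis
    proof cases
      case 1
      then show ?thesis
        using measure_halfspace[OF \<open>e \<noteq> 0\<close>] by simp
    next
      case 2
      then have "{\<alpha>. 0 < \<alpha> \<bullet> e \<and> 0 < \<alpha> \<bullet> x} = {}" by auto
      then have "measure uniform_sphere {\<alpha>. 0 < \<alpha> \<bullet> e \<and> 0 < \<alpha> \<bullet> x} = 0"
        by (simp only: measure_empty)
      with 2 show ?thesis by simp
    next
      case 3
      \<comment> \<open>Gram-Schmidt: r is the sine of the angle \<open>arccos c\<close>, and f is
        the normalised component of x orthogonal to e.\<close>
      define r where "r = sqrt (1 - c\<^sup>2)"
      define f where "f = (1 / r) *\<^sub>R (x - c *\<^sub>R e)"
      have "c\<^sup>2 < 1" using 3 by (simp add: abs_square_less_1)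
      then have r: "0 < r" "r * r = 1 - c\<^sup>2" by (simp_all add: r_def)
      have "(x - c *\<^sub>R e) \<bullet> (x - c *\<^sub>R e) = r * r"
        using e x r by (simp add: inner_diff_left inner_diff_right c_def norm_eq_1 inner_commute power2_eq_square)
      then have "f \<bullet> f = 1" using r(1) by (simp add: f_def)
      then have f: "norm f = 1" by (simp add: norm_eq_1)
      have ef: "e \<bullet> f = 0"
        using e by (simp add: f_def inner_diff_right c_def norm_eq_1)
      have x_eq: "x = cos (arccos c) *\<^sub>R e + sin (arccos c) *\<^sub>R f"
        using 3 r by (simp add: sin_arccos_abs r_def[symmetric] f_def)
      have "AE \<alpha> in uniform_sphere. (0 < \<alpha> \<bullet> e) \<longleftrightarrow>
          (0 < \<alpha> \<bullet> e \<and> 0 < \<alpha> \<bullet> x) \<or> (0 < \<alpha> \<bullet> e \<and> \<alpha> \<bullet> x < 0)"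
        using AE_uniform_sphere_inner_nonzero[OF \<open>x \<noteq> 0\<close>] by (auto elim!: eventually_mono)
      then have "measure uniform_sphere {\<alpha>. 0 < \<alpha> \<bullet> e}
          = measure uniform_sphere ({\<alpha>. 0 < \<alpha> \<bullet> e \<and> 0 < \<alpha> \<bullet> x} \<union> {\<alpha>. 0 < \<alpha> \<bullet> e \<and> \<alpha> \<bullet> x < 0})"
        by (intro uniform_sphere.finite_measure_eq_AE) auto
      also have "\<dots> = measure uniform_sphere {\<alpha>. 0 < \<alpha> \<bullet> e \<and> 0 < \<alpha> \<bullet> x}
          + measure uniform_sphere {\<alpha>. 0 < \<alpha> \<bullet> e \<and> \<alpha> \<bullet> x < 0}"
        by (intro uniform_sphere.finite_measure_Union) auto
      also have "measure uniform_sphere {\<alpha>. 0 < \<alpha> \<bullet> e \<and> \<alpha> \<bullet> x < 0} = arccos c / (2 * pi)"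
        using measure_wedge[OF e f ef, of "arccos c"] 3 arccos_lbound[of c] arccos_ubound[of c]
        unfolding x_eq[symmetric] by simp
      finally show ?thesis
        using measure_halfspace[OF \<open>e \<noteq> 0\<close>] by simp
    qed
  qed
  finally show ?thesis by (simp add: Ang)
qed

text \<open>By antipodal symmetry the triple intersection has the measure of the complement of the
  union. Inclusion-exclusion expresses the union through single and pairwise measures plus the
  triple one; since three is odd, the unknown does not cancel and its double is determined.\<close>

lemma measure_three_halfspaces:
  fixes u1 u2 u3 :: "real ^ 'n"
  assumes "u1 \<noteq> 0" "u2 \<noteq> 0" "u3 \<noteq> 0"
  shows "measure uniform_sphere {\<alpha>. 0 < \<alpha> \<bullet> u1 \<and> 0 < \<alpha> \<bullet> u2 \<and> 0 < \<alpha> \<bullet> u3} = g_fun u1 u2 u3"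
proof -
  define A where "A = (\<lambda>u. {\<alpha>. 0 < \<alpha> \<bullet> (u :: real ^ 'n)})"
  let ?P = "measure (uniform_sphere :: (real ^ 'n) measure)"
  have [simp, measurable]: "A u \<in> sets borel" for u by (simp add: A_def)
  have single: "?P (A u) = 1 / 2" if "u \<noteq> 0" for u
    using measure_halfspace[OF that] by (simp add: A_def)
  \<comment> \<open>The angle is scaled as in the summands of \<open>g_fun\<close>, so that the
    conclusion is linear in these terms.\<close>
  have pair: "?P (A u \<inter> A v) = 1 / 2 - 2 * (1 / (4 * pi) * Ang u v)" if "u \<noteq> 0" "v \<noteq> 0" for u v
    using measure_two_halfspaces[OF that] by (simp add: A_def Int_def)
  have union: "?P (S \<union> T) = ?P S + ?P T - ?P (S \<inter> T)" if "S \<in> sets borel" "T \<in> sets borel" for S T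
    using that by (intro measure_Un3) (auto simp: uniform_sphere.fmeasurable_eq_sets)
  have "?P (A u1 \<inter> A u2 \<inter> A u3) = 1 - ?P (A u1 \<union> A u2 \<union> A u3)"
  proof -
    have "?P (A u1 \<inter> A u2 \<inter> A u3)
        = ?P {\<alpha>. 0 < - \<alpha> \<bullet> u1 \<and> 0 < - \<alpha> \<bullet> u2 \<and> 0 < - \<alpha> \<bullet> u3}"
      using measure_uniform_sphere_uminus[of "\<lambda>\<alpha>. 0 < \<alpha> \<bullet> u1 \<and> 0 < \<alpha> \<bullet> u2 \<and> 0 < \<alpha> \<bullet> u3"]
      by (simp add: A_def Int_def conj_assoc)
    \<comment> \<open>The two sets differ only on the three bounding hyperplanes.\<close>
    also have "\<dots> = ?P (- (A u1 \<union> A u2 \<union> A u3))"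
      using assms[THEN AE_uniform_sphere_inner_nonzero]
      by (intro uniform_sphere.finite_measure_eq_AE) (auto simp: A_def)
    also have "\<dots> = 1 - ?P (A u1 \<union> A u2 \<union> A u3)"
      by (simp add: uniform_sphere.prob_compl[symmetric] Compl_eq_Diff_UNIV)
    finally show ?thesis .
  qed
  also have "?P (A u1 \<union> A u2 \<union> A u3) = ?P (A u1) + ?P (A u2) + ?P (A u3)
      - ?P (A u1 \<inter> A u2) - ?P (A u1 \<inter> A u3) - ?P (A u2 \<inter> A u3) + ?P (A u1 \<inter> A u2 \<inter> A u3)"
  proof -
    have "?P ((A u1 \<union> A u2) \<inter> A u3) = ?P (A u1 \<inter> A u3) + ?P (A u2 \<inter> A u3) - ?P (A u1 \<inter> A u2 \<inter> A u3)"
    proof -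
      have "(A u1 \<inter> A u3) \<inter> (A u2 \<inter> A u3) = A u1 \<inter> A u2 \<inter> A u3" by auto
      then show ?thesis by (simp only: Int_Un_distrib2) (simp add: union)
    qed
    then show ?thesis by (simp add: union)
  qed
  finally have "?P (A u1 \<inter> A u2 \<inter> A u3) = g_fun u1 u2 u3"
    using single[OF assms(1)] single[OF assms(2)] single[OF assms(3)]
      pair[OF assms(1,2)] pair[OF assms(1,3)] pair[OF assms(2,3)]
    unfolding g_fun_def distrib_left by linarith
  then show ?thesis by (simp add: A_def Int_def conj_assoc)
qed

subsection \<open>Separation by a uniform direction\<close>

text \<open>Real-valued so that it can be averaged over directions. Strictness makes ties count as
  no separation, so that \<open>a_sign_eq_sep\<close> holds at all reals.\<close>

definition sep :: "real \<Rightarrow> real \<Rightarrow> real \<Rightarrow> real \<Rightarrow> real" where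
  "sep a b c d = of_bool (max c d < min a b)"

text \<open>If the pair a, c is separated from b, d, the difference inside the sign is twice the gap
  between the pairs; for a, b against c, d it is minus twice the gap. In all other orderings the
  absolute values cancel.\<close>

lemma a_sign_eq_sep: "a_sign a b c d = sep a c b d + sep b d a c - sep a b c d - sep c d a b"
  unfolding a_sign_def sep_def
  by (cases "a < b"; cases "a < c"; cases "a < d"; cases "b < c"; cases "b < d"; cases "c < d")
     (auto simp: sgn_if max_def min_def abs_if)

lemma abs_a_sign_le: "\<bar>a_sign a b c d\<bar> \<le> 1"
  by (simp add: a_sign_def abs_sgn_eq)

lemma borel_measurable_sep [measurable (raw)]:
  assumes [measurable]: "f \<in> borel_measurable M" "g \<in> borel_measurable M"
    "h \<in> borel_measurable M" "k \<in> borel_measurable M"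
  shows "(\<lambda>x. sep (f x) (g x) (h x) (k x)) \<in> borel_measurable M"
  unfolding sep_def of_bool_def by measurable

lemma borel_measurable_a_sign [measurable (raw)]:
  assumes [measurable]: "f \<in> borel_measurable M" "g \<in> borel_measurable M"
    "h \<in> borel_measurable M" "k \<in> borel_measurable M"
  shows "(\<lambda>x. a_sign (f x) (g x) (h x) (k x)) \<in> borel_measurable M"
  unfolding a_sign_eq_sep by measurable

definition sphere_sep :: "real ^ 'n \<Rightarrow> real ^ 'n \<Rightarrow> real ^ 'n \<Rightarrow> real ^ 'n \<Rightarrow> real" where
  "sphere_sep z1 z2 z3 z4 = (\<integral>\<alpha>. sep (\<alpha> \<bullet> z1) (\<alpha> \<bullet> z2) (\<alpha> \<bullet> z3) (\<alpha> \<bullet> z4) \<partial>uniform_sphere)"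

lemma borel_measurable_sphere_sep [measurable (raw)]:
  assumes [measurable]: "f \<in> borel_measurable M" "g \<in> borel_measurable M"
    "h \<in> borel_measurable M" "k \<in> borel_measurable M"
  shows "(\<lambda>x. sphere_sep (f x) (g x) (h x) (k x)) \<in> borel_measurable M"
  unfolding sphere_sep_def by measurable

lemma integrable_uniform_sphere_sep:
  "integrable uniform_sphere (\<lambda>\<alpha>. sep (\<alpha> \<bullet> z1) (\<alpha> \<bullet> z2) (\<alpha> \<bullet> z3) (\<alpha> \<bullet> (z4 :: real ^ 'n)))"
  by (intro uniform_sphere.integrable_const_bound[where B = 1]) (auto simp: sep_def)

lemma sphere_sep_eq_measure:
  "sphere_sep z1 z2 z3 z4
    = measure uniform_sphere {\<alpha>. max (\<alpha> \<bullet> z3) (\<alpha> \<bullet> z4) < min (\<alpha> \<bullet> z1) (\<alpha> \<bullet> z2)}"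
proof -
  have "(\<lambda>\<alpha>. sep (\<alpha> \<bullet> z1) (\<alpha> \<bullet> z2) (\<alpha> \<bullet> z3) (\<alpha> \<bullet> z4))
      = indicator {\<alpha>. max (\<alpha> \<bullet> z3) (\<alpha> \<bullet> z4) < min (\<alpha> \<bullet> z1) (\<alpha> \<bullet> z2)}"
    by (auto simp: sep_def indicator_def fun_eq_iff)
  then show ?thesis
    by (simp add: sphere_sep_def)
qed

lemma abs_sphere_sep_le: "\<bar>sphere_sep z1 z2 z3 z4\<bar> \<le> 1"
  by (simp add: sphere_sep_eq_measure)

text \<open>The antipodal map reverses every comparison, so it is immaterial which pair is on
  top.\<close>

lemma sphere_sep_swap: "sphere_sep z3 z4 z1 z2 = sphere_sep z1 z2 z3 z4"
  using measure_uniform_sphere_uminus[of "\<lambda>\<alpha>. max (\<alpha> \<bullet> z3) (\<alpha> \<bullet> z4) < min (\<alpha> \<bullet> z1) (\<alpha> \<bullet> z2)"]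
  by (simp add: sphere_sep_eq_measure conj_ac)

text \<open>The four summands of \<open>h_fun\<close> are the probabilities of the chains obtained
  by ordering the top pair and the bottom pair. Distinctness keeps all difference vectors nonzero:
  at a zero vector the quotient in \<open>Ang\<close> is 0 by convention, and \<open>g_fun\<close>
  need not vanish although the intersection is empty.\<close>

lemma sphere_sep_eq_h_fun:
  fixes z1 z2 z3 z4 :: "real ^ 'n"
  assumes "distinct [z1, z2, z3, z4]"
  shows "sphere_sep z1 z2 z3 z4 = h_fun z1 z2 z3 z4"
proof -
  define O3 :: "real ^ 'n \<Rightarrow> real ^ 'n \<Rightarrow> real ^ 'n \<Rightarrow> (real ^ 'n) set"
    where "O3 = (\<lambda>u v w. {\<alpha>. 0 < \<alpha> \<bullet> u \<and> 0 < \<alpha> \<bullet> v \<and> 0 < \<alpha> \<bullet> w})"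
  have [measurable]: "O3 u v w \<in> sets borel" for u v w
    by (simp add: O3_def)
  have [simp]: "integrable uniform_sphere (indicator (O3 u v w) :: real ^ 'n \<Rightarrow> real)" for u v w
    by (intro uniform_sphere.integrable_const_bound[where B = 1]) auto
  have g: "measure uniform_sphere (O3 u v w) = g_fun u v w"
    if "u \<noteq> 0" "v \<noteq> 0" "w \<noteq> 0" for u v w
    using measure_three_halfspaces[OF that] by (simp add: O3_def)
  \<comment> \<open>Only ties within a pair have to be excluded; a tie across the pairs is
    compatible with the identity between the indicators.\<close>
  have "z1 - z2 \<noteq> 0" "z3 - z4 \<noteq> 0" using assms by auto
  then have "AE \<alpha> in uniform_sphere. sep (\<alpha> \<bullet> z1) (\<alpha> \<bullet> z2) (\<alpha> \<bullet> z3) (\<alpha> \<bullet> z4) =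
      indicator (O3 (z1 - z2) (z2 - z3) (z3 - z4)) \<alpha> + indicator (O3 (z2 - z1) (z1 - z3) (z3 - z4)) \<alpha>
    + indicator (O3 (z1 - z2) (z2 - z4) (z4 - z3)) \<alpha> + indicator (O3 (z2 - z1) (z1 - z4) (z4 - z3)) \<alpha>"
    using AE_uniform_sphere_inner_nonzero[of "z1 - z2"] AE_uniform_sphere_inner_nonzero[of "z3 - z4"]
    by (auto simp: sep_def O3_def indicator_def inner_diff_right)
  then have "sphere_sep z1 z2 z3 z4 = (\<integral>\<alpha>.
      indicator (O3 (z1 - z2) (z2 - z3) (z3 - z4)) \<alpha> + indicator (O3 (z2 - z1) (z1 - z3) (z3 - z4)) \<alpha>
    + indicator (O3 (z1 - z2) (z2 - z4) (z4 - z3)) \<alpha> + indicator (O3 (z2 - z1) (z1 - z4) (z4 - z3)) \<alpha>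
    \<partial>uniform_sphere)"
    unfolding sphere_sep_def by (intro integral_cong_AE) auto
  also have "\<dots> = h_fun z1 z2 z3 z4"
    using assms not_sym[of z1 z2] not_sym[of z3 z4] by (simp add: g h_fun_def)
  finally show ?thesis .
qed

section \<open>Averaging the sign kernel over directions\<close>

lemma integral_a_sign_uniform_sphere:
  "(\<integral>\<alpha>. a_sign (\<alpha> \<bullet> z1) (\<alpha> \<bullet> z2) (\<alpha> \<bullet> z3) (\<alpha> \<bullet> z4) \<partial>uniform_sphere)
    = 2 * (sphere_sep z1 z3 z2 z4 - sphere_sep z1 z2 z3 z4)"
  unfolding a_sign_eq_sep
  by (simp add: integrable_uniform_sphere_sep sphere_sep_def[symmetric]
      sphere_sep_swap[of z2 z4 z1 z3] sphere_sep_swap[of z3 z4 z1 z2])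

text \<open>The weight W stands for the factor coming from the other vector, so that one statement
  serves both spherical integrals: first W is a sign kernel, then an already averaged kernel.
  Boundedness gives integrability on the product space.\<close>

lemma (in prob_space) integral_a_sign_Fubini:
  fixes f1 f2 f3 f4 :: "'a \<Rightarrow> real ^ 'n"
  assumes [measurable]: "f1 \<in> borel_measurable M" "f2 \<in> borel_measurable M"
      "f3 \<in> borel_measurable M" "f4 \<in> borel_measurable M" "W \<in> borel_measurable M"
    and W: "\<And>x. \<bar>W x\<bar> \<le> C"
  shows "(\<integral>\<alpha>. (\<integral>x. a_sign (\<alpha> \<bullet> f1 x) (\<alpha> \<bullet> f2 x) (\<alpha> \<bullet> f3 x) (\<alpha> \<bullet> f4 x) * W x \<partial>M) \<partial>uniform_sphere)
    = (\<integral>x. 2 * (sphere_sep (f1 x) (f3 x) (f2 x) (f4 x) - sphere_sep (f1 x) (f2 x) (f3 x) (f4 x)) * W x \<partial>M)"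
proof -
  let ?S = "uniform_sphere :: (real ^ 'n) measure"
  interpret P: pair_prob_space M ?S ..
  let ?F = "\<lambda>x \<alpha>. a_sign (\<alpha> \<bullet> f1 x) (\<alpha> \<bullet> f2 x) (\<alpha> \<bullet> f3 x) (\<alpha> \<bullet> f4 x) * W x"
  have "\<bar>?F x \<alpha>\<bar> \<le> C" for x \<alpha>
  proof -
    have "\<bar>a_sign (\<alpha> \<bullet> f1 x) (\<alpha> \<bullet> f2 x) (\<alpha> \<bullet> f3 x) (\<alpha> \<bullet> f4 x)\<bar> \<le> 1"
      by (rule abs_a_sign_le)
    then show ?thesis
      using W[of x] mult_mono[of _ 1 "\<bar>W x\<bar>" C] by (simp add: abs_mult)
  qed
  then have "integrable (M \<Otimes>\<^sub>M ?S) (case_prod ?F)"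
    by (intro P.integrable_const_bound[where B = C]) auto
  from P.Fubini_integral[OF this] show ?thesis
    by (simp add: integral_a_sign_uniform_sphere)
qed

text \<open>By Cauchy-Schwarz the quotient lies in [-1, 1], zero vectors included, so clamping it
  changes nothing and turns \<open>arccos\<close> into a function continuous on the whole
  line.\<close>

lemma borel_measurable_Ang [measurable (raw)]:
  assumes [measurable]: "f \<in> borel_measurable M" "g \<in> borel_measurable M"
  shows "(\<lambda>x. Ang (f x) (g x)) \<in> borel_measurable M"
proof -
  have "\<bar>f x \<bullet> g x / (norm (f x) * norm (g x))\<bar> \<le> 1" for x
    using Cauchy_Schwarz_ineq2[of "f x" "g x"] by (auto simp: abs_mult divide_le_eq)
  then have "Ang (f x) (g x) = arccos (max (-1) (min 1 (f x \<bullet> g x / (norm (f x) * norm (g x)))))" for x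
    unfolding Ang_def by (intro arg_cong[where f = arccos]) (smt (verit))
  moreover have "continuous_on UNIV (\<lambda>t::real. arccos (max (-1) (min 1 t)))"
    by (intro continuous_intros) auto
  from borel_measurable_continuous_on[OF this, of "\<lambda>x. f x \<bullet> g x / (norm (f x) * norm (g x))" M]
  have "(\<lambda>x. arccos (max (-1) (min 1 (f x \<bullet> g x / (norm (f x) * norm (g x)))))) \<in> borel_measurable M"
    by measurable
  ultimately show ?thesis by simp
qed

lemma borel_measurable_h_fun [measurable (raw)]:
  assumes [measurable]: "f \<in> borel_measurable M" "g \<in> borel_measurable M"
    "h \<in> borel_measurable M" "k \<in> borel_measurable M"
  shows "(\<lambda>x. h_fun (f x) (g x) (h x) (k x)) \<in> borel_measurable M"
  unfolding h_fun_def g_fun_def by measurable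

subsection \<open>Independent samples\<close>

text \<open>A continuous distribution function has no atoms, so every section of the diagonal is
  null; by independence the joint law is the product, and Fubini makes the diagonal null.\<close>

lemma (in prob_space) AE_neq_of_continuous_cdf:
  fixes U V :: "'a \<Rightarrow> real"
  assumes indep: "indep_var borel U borel V"
    and cont: "continuous_on UNIV (cdf (distr M borel V))"
  shows "AE x in M. U x \<noteq> V x"
proof -
  have [measurable]: "U \<in> borel_measurable M" "V \<in> borel_measurable M"
    using indep by (auto dest: indep_var_rv1 indep_var_rv2)
  interpret U: prob_space "distr M borel U" by (rule prob_space_distr) simp
  interpret V: prob_space "distr M borel V" by (rule prob_space_distr) simp
  interpret V: real_distribution "distr M borel V" by standard auto
  interpret P: pair_prob_space "distr M borel U" "distr M borel V" ..
  have "AE v in distr M borel V. u \<noteq> v" for u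
  proof -
    have "isCont (cdf (distr M borel V)) u"
      using cont by (simp add: continuous_on_eq_continuous_at)
    then have "measure (distr M borel V) {u} = 0"
      by (simp add: V.isCont_cdf)
    then have "emeasure (distr M borel V) {u} = 0"
      by (simp add: V.emeasure_eq_measure)
    then show ?thesis
      by (subst AE_iff_measurable[OF _ refl]) auto
  qed
  then have "AE p in distr M borel U \<Otimes>\<^sub>M distr M borel V. fst p \<noteq> snd p"
  proof (intro P.AE_pair_measure)
    show "{p \<in> space (distr M borel U \<Otimes>\<^sub>M distr M borel V). fst p \<noteq> snd p}
        \<in> sets (distr M borel U \<Otimes>\<^sub>M distr M borel V)"
      by measurable
  qed simp
  also have "distr M borel U \<Otimes>\<^sub>M distr M borel V = distr M (borel \<Otimes>\<^sub>M borel) (\<lambda>x. (U x, V x))"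
    using indep by (simp add: indep_var_distribution_eq)
  finally show ?thesis
    by (subst (asm) AE_distr_iff) auto
qed

text \<open>A single good direction suffices: points with different projections are different, and
  there are only countably many pairs of indices. The map F is a coordinate projection in the
  application.\<close>

lemma (in prob_space) AE_inj_on_of_continuous_cdf:
  fixes Z :: "'i \<Rightarrow> 'a \<Rightarrow> 'c::topological_space" and F :: "'c \<Rightarrow> real ^ 'n"
  assumes "countable I"
    and indep: "indep_vars (\<lambda>_. borel) Z I"
    and distr: "\<And>i. i \<in> I \<Longrightarrow> distr M borel (Z i) = P"
    and [measurable]: "F \<in> borel_measurable borel"
    and cont: "AE \<alpha> in uniform_sphere. continuous_on UNIV (cdf (distr P borel (\<lambda>z. \<alpha> \<bullet> F z)))"
  shows "AE x in M. inj_on (\<lambda>i. F (Z i x)) I"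
proof -
  obtain \<alpha> where \<alpha>: "continuous_on UNIV (cdf (distr P borel (\<lambda>z. \<alpha> \<bullet> F z)))"
    using eventually_happens[OF cont] uniform_sphere.ae_filter_bot by blast
  have neq: "AE x in M. F (Z i x) \<noteq> F (Z j x)" if ij: "i \<in> I" "j \<in> I" "i \<noteq> j" for i j
  proof -
    have [measurable]: "Z j \<in> borel_measurable M"
      using indep ij by (auto simp: indep_vars_def)
    have "indep_var borel (Z i) borel (Z j)"
    proof -
      \<comment> \<open>Pairwise independence comes from the blocks of the family over the disjoint
        singletons {i} and {j}.\<close>
      have "indep_var borel ((\<lambda>\<omega>. \<omega> i) \<circ> (\<lambda>x. \<lambda>k\<in>{i}. Z k x)) borel ((\<lambda>\<omega>. \<omega> j) \<circ> (\<lambda>x. \<lambda>k\<in>{j}. Z k x))"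
        using ij by (intro indep_var_compose[OF indep_var_restrict[OF indep]]) auto
      then show ?thesis by (simp add: comp_def)
    qed
    from indep_var_compose[OF this, of "\<lambda>z. \<alpha> \<bullet> F z" borel "\<lambda>z. \<alpha> \<bullet> F z" borel]
    have "indep_var borel (\<lambda>x. \<alpha> \<bullet> F (Z i x)) borel (\<lambda>x. \<alpha> \<bullet> F (Z j x))"
      by (simp add: comp_def)
    moreover have "distr M borel (\<lambda>x. \<alpha> \<bullet> F (Z j x)) = distr P borel (\<lambda>z. \<alpha> \<bullet> F z)"
      unfolding distr[OF ij(2), symmetric] by (subst distr_distr) (auto simp: comp_def)
    ultimately have "AE x in M. \<alpha> \<bullet> F (Z i x) \<noteq> \<alpha> \<bullet> F (Z j x)"
      using \<alpha> by (intro AE_neq_of_continuous_cdf) simp_all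
    then show ?thesis by (auto elim!: eventually_mono)
  qed
  have "AE x in M. \<forall>i\<in>I. \<forall>j\<in>I. i \<noteq> j \<longrightarrow> F (Z i x) \<noteq> F (Z j x)"
    using neq assms(1) by (auto simp: AE_ball_countable)
  then show ?thesis
    by (auto elim!: eventually_mono simp: inj_on_def)
qed

text \<open>The joint law is a product of copies of P, and such a product is invariant under
  injective reindexing.\<close>

lemma (in prob_space) expectation_iid_reindex:
  fixes Z :: "'i \<Rightarrow> 'a \<Rightarrow> 'c::topological_space" and \<phi> :: "('i \<Rightarrow> 'c) \<Rightarrow> real"
  assumes "I \<noteq> {}"
    and indep: "indep_vars (\<lambda>_. borel) Z I"
    and distr: "\<And>i. i \<in> I \<Longrightarrow> distr M borel (Z i) = P"
    and \<sigma>: "inj_on \<sigma> I" "\<sigma> \<in> I \<rightarrow> I"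
    and [measurable]: "\<phi> \<in> borel_measurable (\<Pi>\<^sub>M i\<in>I. borel)"
  shows "(\<integral>x. \<phi> (\<lambda>i\<in>I. Z (\<sigma> i) x) \<partial>M) = (\<integral>x. \<phi> (\<lambda>i\<in>I. Z i x) \<partial>M)"
proof -
  have Z [measurable]: "\<And>i. i \<in> I \<Longrightarrow> Z i \<in> borel_measurable M"
    using indep by (auto simp: indep_vars_def)
  have [measurable]: "\<sigma> i \<in> I" if "i \<in> I" for i
    using \<sigma>(2) that by auto
  obtain i where "i \<in> I" using assms(1) by auto
  then have P: "prob_space P" and [measurable_cong]: "sets P = sets borel"
    using distr[of i] Z[of i] prob_space_distr[of "Z i" borel] by auto
  have joint: "distr M (\<Pi>\<^sub>M i\<in>I. borel) (\<lambda>x. \<lambda>i\<in>I. Z i x) = (\<Pi>\<^sub>M i\<in>I. P)"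
  proof -
    have "distr M (\<Pi>\<^sub>M i\<in>I. borel) (\<lambda>x. \<lambda>i\<in>I. Z i x) = (\<Pi>\<^sub>M i\<in>I. distr M borel (Z i))"
      using indep_vars_iff_distr_eq_PiM'[of I Z "\<lambda>_. borel"] indep assms(1) by simp
    then show ?thesis by (simp add: distr cong: PiM_cong)
  qed
  have reindex: "distr (\<Pi>\<^sub>M i\<in>I. P) (\<Pi>\<^sub>M i\<in>I. P) (\<lambda>\<omega>. \<lambda>i\<in>I. \<omega> (\<sigma> i)) = (\<Pi>\<^sub>M i\<in>I. P)"
    using distr_PiM_reindex[of I "\<lambda>_. P" \<sigma> I] P \<sigma> by simp
  have "(\<integral>x. \<phi> (\<lambda>i\<in>I. Z (\<sigma> i) x) \<partial>M) = (\<integral>x. \<phi> (\<lambda>i\<in>I. (\<lambda>j\<in>I. Z j x) (\<sigma> i)) \<partial>M)"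
    using \<sigma>(2) by (intro Bochner_Integration.integral_cong arg_cong[where f = \<phi>] restrict_ext) auto
  also have "\<dots> = (\<integral>\<omega>. \<phi> (\<lambda>i\<in>I. \<omega> (\<sigma> i)) \<partial>(\<Pi>\<^sub>M i\<in>I. P))"
    unfolding joint[symmetric] by (subst integral_distr) auto
  also have "\<dots> = (\<integral>\<omega>. \<phi> \<omega> \<partial>(\<Pi>\<^sub>M i\<in>I. P))"
    by (subst (2) reindex[symmetric], subst integral_distr) auto
  also have "\<dots> = (\<integral>x. \<phi> (\<lambda>i\<in>I. Z i x) \<partial>M)"
    unfolding joint[symmetric] by (subst integral_distr) auto
  finally show ?thesis .
qed

section \<open>Combining spherical averages, exchangeability and almost sure distinctness\<close>

theorem theorem7p3:
  fixes M :: "'a measure"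
    and P_XY :: "((real ^ 'p) \<times> (real ^ 'q)) measure"
    and X :: "nat \<Rightarrow> 'a \<Rightarrow> real ^ 'p"
    and Y :: "nat \<Rightarrow> 'a \<Rightarrow> real ^ 'q"
  assumes "prob_space M"
    and "prob_space.indep_vars M (\<lambda>_. borel) (\<lambda>i \<omega>. (X i \<omega>, Y i \<omega>)) {1..4}"
    and "\<And>i. i \<in> {1..4} \<Longrightarrow> distr M borel (\<lambda>\<omega>. (X i \<omega>, Y i \<omega>)) = P_XY"
    and "AE \<alpha> in uniform_sphere. continuous_on UNIV (cdf (distr P_XY borel (\<lambda>z. \<alpha> \<bullet> fst z)))"
    and "AE \<beta> in uniform_sphere. continuous_on UNIV (cdf (distr P_XY borel (\<lambda>z. \<beta> \<bullet> snd z)))"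
  shows "tau_star M X Y =
    4 * ((\<integral>\<omega>. h_fun (X 1 \<omega>) (X 2 \<omega>) (X 3 \<omega>) (X 4 \<omega>)
             * h_fun (Y 1 \<omega>) (Y 2 \<omega>) (Y 3 \<omega>) (Y 4 \<omega>) \<partial>M)
       + (\<integral>\<omega>. h_fun (X 1 \<omega>) (X 2 \<omega>) (X 3 \<omega>) (X 4 \<omega>)
             * h_fun (Y 3 \<omega>) (Y 4 \<omega>) (Y 1 \<omega>) (Y 2 \<omega>) \<partial>M)
       - 2 * (\<integral>\<omega>. h_fun (X 1 \<omega>) (X 2 \<omega>) (X 3 \<omega>) (X 4 \<omega>)
             * h_fun (Y 1 \<omega>) (Y 3 \<omega>) (Y 2 \<omega>) (Y 4 \<omega>) \<partial>M))"
proof -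
  interpret prob_space M by fact
  note indep = assms(2) and law = assms(3) and cont_X = assms(4) and cont_Y = assms(5)
  let ?Z = "\<lambda>i \<omega>. (X i \<omega>, Y i \<omega>)"
  have Z [measurable]: "?Z i \<in> borel_measurable M" if "i \<in> {1..4}" for i
    using indep that by (simp add: indep_vars_def)
  have X_meas: "X i \<in> borel_measurable M" if "i \<in> {1..4}" for i
    using measurable_compose[OF Z[OF that], of fst borel]
    by (simp add: borel_measurable_continuous_onI continuous_on_fst)
  have Y_meas: "Y i \<in> borel_measurable M" if "i \<in> {1..4}" for i
    using measurable_compose[OF Z[OF that], of snd borel]
    by (simp add: borel_measurable_continuous_onI continuous_on_snd)
  have [measurable]: "X 1 \<in> borel_measurable M" "X 2 \<in> borel_measurable M"
    "X 3 \<in> borel_measurable M" "X 4 \<in> borel_measurable M"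
    "Y 1 \<in> borel_measurable M" "Y 2 \<in> borel_measurable M"
    "Y 3 \<in> borel_measurable M" "Y 4 \<in> borel_measurable M"
    by (intro X_meas Y_meas; simp)+

  \<comment> \<open>The computation runs on separation probabilities, which are bounded and
    symmetric at every sample point; \<open>h_fun\<close> replaces them only at the end, off a null
    set.\<close>
  define KX where "KX = (\<lambda>i j k l \<omega>. sphere_sep (X i \<omega>) (X j \<omega>) (X k \<omega>) (X l \<omega>))"
  define KY where "KY = (\<lambda>i j k l \<omega>. sphere_sep (Y i \<omega>) (Y j \<omega>) (Y k \<omega>) (Y l \<omega>))"
  have bound: "\<bar>KX i j k l \<omega>\<bar> \<le> 1" "\<bar>KY i j k l \<omega>\<bar> \<le> 1" for i j k l \<omega>
    by (simp_all add: KX_def KY_def abs_sphere_sep_le)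
  have KK [measurable]: "KX 1 2 3 4 \<in> borel_measurable M" "KX 1 3 2 4 \<in> borel_measurable M"
    "KY 1 2 3 4 \<in> borel_measurable M" "KY 1 3 2 4 \<in> borel_measurable M"
    unfolding KX_def KY_def by measurable
  have integrable_KK: "integrable M (\<lambda>\<omega>. KX i j k l \<omega> * KY i' j' k' l' \<omega>)"
    if [measurable]: "KX i j k l \<in> borel_measurable M" "KY i' j' k' l' \<in> borel_measurable M"
    for i j k l i' j' k' l'
    by (intro integrable_const_bound[where B = 1])
      (use bound in \<open>auto simp: abs_mult intro!: mult_le_one\<close>)

  \<comment> \<open>Two uses of Fubini: over \<beta> with the sign kernel of X as weight, bounded by
    1, then over \<alpha> with the averaged kernel of Y as weight, bounded by 4.\<close>
  have tau: "tau_star M X Y = (\<integral>\<omega>. 2 * (KX 1 3 2 4 \<omega> - KX 1 2 3 4 \<omega>) * (2 * (KY 1 3 2 4 \<omega> - KY 1 2 3 4 \<omega>)) \<partial>M)"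
  proof -
    have "(\<integral>\<beta>. (\<integral>\<omega>. a_sign (\<alpha> \<bullet> X 1 \<omega>) (\<alpha> \<bullet> X 2 \<omega>) (\<alpha> \<bullet> X 3 \<omega>) (\<alpha> \<bullet> X 4 \<omega>)
         * a_sign (\<beta> \<bullet> Y 1 \<omega>) (\<beta> \<bullet> Y 2 \<omega>) (\<beta> \<bullet> Y 3 \<omega>) (\<beta> \<bullet> Y 4 \<omega>) \<partial>M) \<partial>uniform_sphere)
      = (\<integral>\<omega>. a_sign (\<alpha> \<bullet> X 1 \<omega>) (\<alpha> \<bullet> X 2 \<omega>) (\<alpha> \<bullet> X 3 \<omega>) (\<alpha> \<bullet> X 4 \<omega>)
         * (2 * (KY 1 3 2 4 \<omega> - KY 1 2 3 4 \<omega>)) \<partial>M)" for \<alpha>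
      using integral_a_sign_Fubini[of "Y 1" "Y 2" "Y 3" "Y 4"
          "\<lambda>\<omega>. a_sign (\<alpha> \<bullet> X 1 \<omega>) (\<alpha> \<bullet> X 2 \<omega>) (\<alpha> \<bullet> X 3 \<omega>) (\<alpha> \<bullet> X 4 \<omega>)" 1]
      by (simp add: KY_def mult.commute abs_a_sign_le del: One_nat_def)
    moreover have "\<bar>2 * (KY 1 3 2 4 \<omega> - KY 1 2 3 4 \<omega>)\<bar> \<le> 4" for \<omega>
      using bound(2)[of 1 3 2 4 \<omega>] bound(2)[of 1 2 3 4 \<omega>]
      by (simp add: abs_le_iff del: One_nat_def)
    ultimately show ?thesis
      unfolding tau_star_def
      using integral_a_sign_Fubini[of "X 1" "X 2" "X 3" "X 4" "\<lambda>\<omega>. 2 * (KY 1 3 2 4 \<omega> - KY 1 2 3 4 \<omega>)" 4]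
      by (simp add: KX_def del: One_nat_def)
  qed

  \<comment> \<open>Observations 2 and 3 are exchanged simultaneously in X and Y. The choice a = 3,
    b = 2 identifies the two diagonal terms of the product, a = 2, b = 3 the two cross
    terms.\<close>
  have exchange: "(\<integral>\<omega>. KX 1 3 2 4 \<omega> * KY 1 a b 4 \<omega> \<partial>M) = (\<integral>\<omega>. KX 1 2 3 4 \<omega> * KY 1 b a 4 \<omega> \<partial>M)"
    if ab: "a = 2 \<and> b = 3 \<or> a = 3 \<and> b = 2" for a b
  proof -
    let ?\<phi> = "\<lambda>z :: nat \<Rightarrow> (real ^ 'p) \<times> (real ^ 'q).
      sphere_sep (fst (z 1)) (fst (z 2)) (fst (z 3)) (fst (z 4)) *
      sphere_sep (snd (z 1)) (snd (z b)) (snd (z a)) (snd (z 4))"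
    have [measurable]: "fst \<in> borel_measurable (borel :: ((real ^ 'p) \<times> (real ^ 'q)) measure)"
      "snd \<in> borel_measurable (borel :: ((real ^ 'p) \<times> (real ^ 'q)) measure)"
      by (intro borel_measurable_continuous_onI continuous_intros)+
    have [measurable]: "(\<lambda>z. z i) \<in> borel_measurable (\<Pi>\<^sub>M i\<in>{1..4::nat}. (borel :: ((real ^ 'p) \<times> (real ^ 'q)) measure))"
      if "i \<in> {1, 2, 3, 4}" for i
      using that by (intro measurable_component_singleton) auto
    have "?\<phi> \<in> borel_measurable (\<Pi>\<^sub>M i\<in>{1..4}. borel)"
      using ab by auto
    moreover have "inj_on (Transposition.transpose 2 3) {1..4}" "Transposition.transpose 2 3 \<in> {1..4} \<rightarrow> {1..4::nat}"
      by (auto simp: Transposition.transpose_def inj_on_def)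
    ultimately have "(\<integral>\<omega>. ?\<phi> (\<lambda>i\<in>{1..4}. ?Z (Transposition.transpose 2 3 i) \<omega>) \<partial>M) = (\<integral>\<omega>. ?\<phi> (\<lambda>i\<in>{1..4}. ?Z i \<omega>) \<partial>M)"
      using indep law by (intro expectation_iid_reindex) auto
    then show ?thesis
      using ab by (auto simp: KX_def KY_def Transposition.transpose_def simp del: One_nat_def)
  qed

  have XY_inj: "AE \<omega> in M. inj_on (\<lambda>i. X i \<omega>) {1..4} \<and> inj_on (\<lambda>i. Y i \<omega>) {1..4}"
    using AE_inj_on_of_continuous_cdf[OF _ indep law _ cont_X]
      AE_inj_on_of_continuous_cdf[OF _ indep law _ cont_Y]
    by (simp add: borel_measurable_continuous_onI continuous_on_fst continuous_on_snd)
  \<comment> \<open>By \<open>sphere_sep_swap\<close> both (Y1, Y2, Y3, Y4) and (Y3, Y4, Y1, Y2)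
    lead to \<open>KY 1 2 3 4\<close>, so the first two expectations of the formula agree.\<close>
  then have h_eq: "AE \<omega> in M. h_fun (X 1 \<omega>) (X 2 \<omega>) (X 3 \<omega>) (X 4 \<omega>) = KX 1 2 3 4 \<omega>
      \<and> h_fun (Y 1 \<omega>) (Y 2 \<omega>) (Y 3 \<omega>) (Y 4 \<omega>) = KY 1 2 3 4 \<omega>
      \<and> h_fun (Y 3 \<omega>) (Y 4 \<omega>) (Y 1 \<omega>) (Y 2 \<omega>) = KY 1 2 3 4 \<omega>
      \<and> h_fun (Y 1 \<omega>) (Y 3 \<omega>) (Y 2 \<omega>) (Y 4 \<omega>) = KY 1 3 2 4 \<omega>"
  proof eventually_elim
    case (elim \<omega>)
    then have "X i \<omega> \<noteq> X j \<omega>" "Y i \<omega> \<noteq> Y j \<omega>" if "i \<in> {1..4}" "j \<in> {1..4}" "i \<noteq> j" for i j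
      using that by (auto dest: inj_onD)
    then show ?case
      by (simp add: KX_def KY_def sphere_sep_eq_h_fun[symmetric] sphere_sep_swap[of "Y 1 \<omega>"] del: One_nat_def)
  qed
  have h1: "(\<integral>\<omega>. h_fun (X 1 \<omega>) (X 2 \<omega>) (X 3 \<omega>) (X 4 \<omega>) * h_fun (Y 1 \<omega>) (Y 2 \<omega>) (Y 3 \<omega>) (Y 4 \<omega>) \<partial>M)
      = (\<integral>\<omega>. KX 1 2 3 4 \<omega> * KY 1 2 3 4 \<omega> \<partial>M)"
    by (rule integral_cong_AE; (rule eventually_mono[OF h_eq], simp del: One_nat_def | measurable))
  have h2: "(\<integral>\<omega>. h_fun (X 1 \<omega>) (X 2 \<omega>) (X 3 \<omega>) (X 4 \<omega>) * h_fun (Y 3 \<omega>) (Y 4 \<omega>) (Y 1 \<omega>) (Y 2 \<omega>) \<partial>M)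
      = (\<integral>\<omega>. KX 1 2 3 4 \<omega> * KY 1 2 3 4 \<omega> \<partial>M)"
    by (rule integral_cong_AE; (rule eventually_mono[OF h_eq], simp del: One_nat_def | measurable))
  have h3: "(\<integral>\<omega>. h_fun (X 1 \<omega>) (X 2 \<omega>) (X 3 \<omega>) (X 4 \<omega>) * h_fun (Y 1 \<omega>) (Y 3 \<omega>) (Y 2 \<omega>) (Y 4 \<omega>) \<partial>M)
      = (\<integral>\<omega>. KX 1 2 3 4 \<omega> * KY 1 3 2 4 \<omega> \<partial>M)"
    by (rule integral_cong_AE; (rule eventually_mono[OF h_eq], simp del: One_nat_def | measurable))

  \<comment> \<open>The coefficient 4 is the product of the two factors 2 from the spherical
    averages of X and Y.\<close>
  have "tau_star M X Y = (\<integral>\<omega>. 4 * (KX 1 3 2 4 \<omega> * KY 1 3 2 4 \<omega> + KX 1 2 3 4 \<omega> * KY 1 2 3 4 \<omega>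
      - KX 1 3 2 4 \<omega> * KY 1 2 3 4 \<omega> - KX 1 2 3 4 \<omega> * KY 1 3 2 4 \<omega>) \<partial>M)"
    unfolding tau by (intro Bochner_Integration.integral_cong) (simp_all add: algebra_simps del: One_nat_def)
  also have "\<dots> = 4 * ((\<integral>\<omega>. KX 1 3 2 4 \<omega> * KY 1 3 2 4 \<omega> \<partial>M) + (\<integral>\<omega>. KX 1 2 3 4 \<omega> * KY 1 2 3 4 \<omega> \<partial>M)
      - (\<integral>\<omega>. KX 1 3 2 4 \<omega> * KY 1 2 3 4 \<omega> \<partial>M) - (\<integral>\<omega>. KX 1 2 3 4 \<omega> * KY 1 3 2 4 \<omega> \<partial>M))"
    by (simp add: integrable_KK del: One_nat_def)
  \<comment> \<open>The exchange leaves twice a diagonal term minus twice a cross term; the two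
    equal expectations \<open>h1\<close> and \<open>h2\<close> make up the former, \<open>h3\<close>
    the latter.\<close>
  finally show ?thesis
    unfolding h1 h2 h3 using exchange[of 3 2] exchange[of 2 3] by (simp del: One_nat_def)
qed

end
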